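(* Let $R_0,R_1,R_2\in\mathbb{C}^{n,n}$ be Hermitian positive semi-definite and let $J\in\mathbb{C}^{n,n}$ be skew-Hermitian. Assume that $\ker R_0\cap\ker R_1\cap\ker R_2\cap\ker J=\{0\}$. Then the multivariate matrix polynomial $z_1z_2R_2+z_2(J+R_1)+R_0$ is stable with respect to $H_{\pi/2}^2$. In consequence, $P(\lambda)=\lambda^2R_2+\lambda(J+R_1)+R_0$ is a regular matrix polynomial, hyperstable with respect to the open right half-plane $H_{\pi/2}$.
   Context: $H_{\pi/2}=\{z\in\mathbb{C}:\operatorname{Re}z>0\}$. For a nonempty open or closed $D\subseteq\mathbb{C}$: a two-variable matrix polynomial $R(z_1,z_2)$ with coefficients in $\mathbb{C}^{n,n}$ is stable with respect to $D^2$ if $R(\mu_1,\mu_2)x\neq0$ for all $(\mu_1,\mu_2)\in D^2$ and all $x\in\mathbb{C}^n\setminus\{0\}$; a one-variable matrix polynomial $P(\lambda)$ is hyperstable with respect to $D$ if for every $x\in\mathbb{C}^n\setminus\{0\}$ there exists $y\in\mathbb{C}^n\setminus\{0\}$ such that $y^*P(\mu)x\neq0$ for all $\mu\in D$. $P(\lambda)$ is regular if $\lambda\mapsto\det P(\lambda)$ is a nonzero polynomial. *)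

theory Defs
  imports "HOL-Analysis.Analysis" "HOL-Computational_Algebra.Polynomial"
begin

definition adj :: "complex^'n^'m \<Rightarrow> complex^'m^'n" where
  "adj A = (\<chi> i j. cnj (A $ j $ i))"

(* the number y^* v; HOL-Analysis only provides the real inner product on these vectors *)
definition cdot :: "complex^'n \<Rightarrow> complex^'n \<Rightarrow> complex" where
  "cdot y v = (\<Sum>i\<in>UNIV. cnj (y $ i) * v $ i)"

definition hermitian :: "complex^'n^'n \<Rightarrow> bool" where
  "hermitian A \<longleftrightarrow> adj A = A"

definition skew_hermitian :: "complex^'n^'n \<Rightarrow> bool" where
  "skew_hermitian A \<longleftrightarrow> adj A = - A"

(* Re loses nothing here, because the quadratic form of a Hermitian matrix is real *)
definition hermitian_psd :: "complex^'n^'n \<Rightarrow> bool" where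
  "hermitian_psd A \<longleftrightarrow> hermitian A \<and> (\<forall>x. Re (cdot x (A *v x)) \<ge> 0)"

definition mker :: "complex^'n^'m \<Rightarrow> (complex^'n) set" where
  "mker A = {x. A *v x = 0}"

definition mscale :: "complex \<Rightarrow> complex^'n^'m \<Rightarrow> complex^'n^'m" where
  "mscale c A = (\<chi> i j. c * A $ i $ j)"

(* Matrix polynomials are polynomials with matrix coefficients.  Only coeff, degree and pCons
   are used: the library's product on complex^'n^'n is entrywise, so the multiplication
   and evaluation (poly) of the polynomial library do not have the intended meaning here.
   A two-variable matrix polynomial is a polynomial in z2 whose coefficients are matrix
   polynomials in z1. *)
type_synonym 'n mpoly1 = "(complex^'n^'n) poly"
type_synonym 'n mpoly2 = "(complex^'n^'n) poly poly"

definition meval :: "'n::finite mpoly1 \<Rightarrow> complex \<Rightarrow> complex^'n^'n" where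
  "meval P z = (\<Sum>k\<le>degree P. mscale (z ^ k) (coeff P k))"

definition meval2 :: "'n::finite mpoly2 \<Rightarrow> complex \<Rightarrow> complex \<Rightarrow> complex^'n^'n" where
  "meval2 R z1 z2 = (\<Sum>k\<le>degree R. mscale (z2 ^ k) (meval (coeff R k) z1))"

definition poly_entries :: "'n::finite mpoly1 \<Rightarrow> complex poly^'n^'n" where
  "poly_entries P = (\<chi> i j. map_poly (\<lambda>A. A $ i $ j) P)"

definition regular :: "'n::finite mpoly1 \<Rightarrow> bool" where
  "regular P \<longleftrightarrow> det (poly_entries P) \<noteq> 0"

definition stable2 :: "complex set \<Rightarrow> 'n::finite mpoly2 \<Rightarrow> bool" where
  "stable2 D R \<longleftrightarrow> (\<forall>\<mu>1\<in>D. \<forall>\<mu>2\<in>D. \<forall>x. x \<noteq> 0 \<longrightarrow> meval2 R \<mu>1 \<mu>2 *v x \<noteq> 0)"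

definition hyperstable :: "complex set \<Rightarrow> 'n::finite mpoly1 \<Rightarrow> bool" where
  "hyperstable D P \<longleftrightarrow>
     (\<forall>x. x \<noteq> 0 \<longrightarrow> (\<exists>y. y \<noteq> 0 \<and> (\<forall>\<mu>\<in>D. cdot y (meval P \<mu> *v x) \<noteq> 0)))"

definition right_half_plane :: "complex set" where
  "right_half_plane = {z. Re z > 0}"

lemma mscale_simps [simp]:
  "mscale 1 A = A" "mscale c 0 = 0" "mscale c (mscale d A) = mscale (c * d) A"
  "mscale c (A + B) = mscale c A + mscale c B"
  by (simp_all add: mscale_def vec_eq_iff algebra_simps)

lemma mscale_sum: "mscale c (sum f S) = (\<Sum>k\<in>S. mscale c (f k))"
  by (induction S rule: infinite_finite_induct) simp_all

lemma meval_0 [simp]: "meval 0 z = 0"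
  by (simp add: meval_def)

lemma meval_pCons [simp]: "meval (pCons A P) z = A + mscale z (meval P z)"
  by (cases "P = 0") (simp_all add: meval_def sum.atMost_Suc_shift mscale_sum del: sum.atMost_Suc)

lemma meval2_0 [simp]: "meval2 0 z1 z2 = 0"
  by (simp add: meval2_def)

lemma meval2_pCons [simp]:
  "meval2 (pCons A R) z1 z2 = meval A z1 + mscale z2 (meval2 R z1 z2)"
  by (cases "R = 0") (simp_all add: meval2_def sum.atMost_Suc_shift mscale_sum del: sum.atMost_Suc)

lemma meval_quadratic:
  "meval [:A, B, C:] z = mscale (z\<^sup>2) C + mscale z B + A"
  by (simp add: power2_eq_square algebra_simps)

lemma meval2_quadratic:
  "meval2 [:[:A:], [:B, C:]:] z1 z2 = mscale (z1 * z2) C + mscale z2 B + A"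
  by (simp add: algebra_simps)

lemma poly_entries_eval: "poly (poly_entries P $ i $ j) z = meval P z $ i $ j"
proof (induction P)
  case 0
  then show ?case by (simp add: poly_entries_def)
next
  case (pCons A P)
  then show ?case by (simp add: poly_entries_def map_poly_pCons mscale_def)
qed

lemma poly_det_entries: "poly (det (poly_entries P)) z = det (meval P z)"
  by (simp add: det_def poly_sum poly_prod poly_entries_eval)

end

theory Submission
  imports Defs
begin

text \<open>
  Dividing $x^* R(z_1,z_2) x$ by $z_2$ gives
  $z_1\, x^*R_2x + x^*Jx + x^*R_1x + z_2^{-1}\, x^*R_0x$, whose real part is positive on the right
  half-plane unless all three positive semi-definite forms vanish at $x$. In that case
  $R_0x = R_1x = R_2x = 0$, so $R(z_1,z_2)x = z_2 Jx$ with $Jx \neq 0$. For hyperstability at $x$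
  one can therefore take $y = x$ in the first case and $y = Jx$ in the second.
\<close>

lemma mscale_mult_vec: "mscale c A *v x = c *s (A *v x)"
  by (simp add: mscale_def matrix_vector_mult_def vec_eq_iff sum_distrib_left mult.assoc)

lemma cdot_simps [simp]:
  "cdot y (u + v) = cdot y u + cdot y v"
  "cdot y (u - v) = cdot y u - cdot y v"
  "cdot (y - w) u = cdot y u - cdot w u"
  "cdot y (c *s u) = c * cdot y u"
  "cdot (c *s y) u = cnj c * cdot y u"
  "cdot y 0 = 0"
  by (simp_all add: cdot_def algebra_simps sum.distrib sum_subtractf sum_distrib_left)

lemma cdot_commute: "cdot u v = cnj (cdot v u)"
  by (simp add: cdot_def mult.commute)

lemma cdot_self: "cdot u u = of_real ((norm u)\<^sup>2)"
  by (simp add: cdot_def norm_vec_def L2_set_def sum_nonneg complex_norm_square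
      mult.commute del: of_real_power)

lemma cdot_mult_vec: "cdot y (A *v x) = cdot (adj A *v y) x"
proof -
  have "cdot y (A *v x) = (\<Sum>i\<in>UNIV. \<Sum>j\<in>UNIV. cnj (y $ i) * A $ i $ j * x $ j)"
    by (simp add: cdot_def matrix_vector_mult_def sum_distrib_left mult.assoc)
  also have "\<dots> = (\<Sum>j\<in>UNIV. \<Sum>i\<in>UNIV. cnj (y $ i) * A $ i $ j * x $ j)"
    by (rule sum.swap)
  also have "\<dots> = cdot (adj A *v y) x"
    by (simp add: cdot_def matrix_vector_mult_def adj_def sum_distrib_left
        sum_distrib_right mult_ac)
  finally show ?thesis .
qed

text \<open>Moving \<open>A\<close> across the form shows that its value equals its own
  conjugate.\<close>

lemma hermitian_form_real:
  assumes "hermitian A"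
  shows "Im (cdot x (A *v x)) = 0"
proof -
  have "cdot x (A *v x) = cdot (A *v x) x"
    using assms by (metis cdot_mult_vec hermitian_def)
  also have "\<dots> = cnj (cdot x (A *v x))"
    by (rule cdot_commute)
  finally have "Im (cdot x (A *v x)) = Im (cnj (cdot x (A *v x)))"
    by (rule arg_cong)
  then show ?thesis by simp
qed

text \<open>Here moving \<open>A\<close> across the form costs a sign, so the value is minus its own
  conjugate.\<close>

lemma skew_hermitian_form_imaginary:
  assumes "skew_hermitian A"
  shows "Re (cdot x (A *v x)) = 0"
proof -
  have "cdot x (A *v x) = cdot ((- A) *v x) x"
    using assms by (metis cdot_mult_vec skew_hermitian_def)
  also have "\<dots> = - cdot (A *v x) x"
    by (simp add: cdot_def matrix_vector_mult_def sum_negf)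
  also have "\<dots> = - cnj (cdot x (A *v x))"
    by (subst cdot_commute) (rule refl)
  finally have "Re (cdot x (A *v x)) = Re (- cnj (cdot x (A *v x)))"
    by (rule arg_cong)
  then show ?thesis by simp
qed

text \<open>A zero of a nonnegative form is a minimum, so the derivative there, governed by
  \<open>A *v x\<close>, must vanish.\<close>

lemma psd_form_zero_imp_kernel:
  assumes "hermitian_psd A" and form: "Re (cdot x (A *v x)) = 0"
  shows "A *v x = 0"
proof (rule ccontr)
  define v where "v = A *v x"
  define c where "c = Re (cdot v (A *v v))"
  define n where "n = (norm v)\<^sup>2"
  assume "A *v x \<noteq> 0"
  then have n: "n > 0" by (simp add: n_def v_def)
  have adj: "adj A = A" and psd: "\<And>z. Re (cdot z (A *v z)) \<ge> 0"
    using assms(1) by (auto simp: hermitian_psd_def hermitian_def)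
  have c: "c \<ge> 0" by (simp add: c_def psd)
  \<comment> \<open>The form at \<open>x - t Ax\<close> is \<open>t\<^sup>2 c - 2 t n\<close>, which would be negative for small \<open>t > 0\<close>.\<close>
  have "2 * t * n \<le> t\<^sup>2 * c" for t :: real
  proof -
    define z where "z = x - of_real t *s v"
    have "A *v z = v - of_real t *s (A *v v)"
      by (simp add: z_def v_def matrix_vector_mult_diff_distrib vector_scalar_commute)
    \<comment> \<open>By symmetry of \<open>A\<close> both cross terms of the expansion are
      \<open>- t * n\<close>; the constant term is zero by \<open>form\<close>.\<close>
    moreover have "cdot x (A *v v) = cdot v v"
      by (simp add: cdot_mult_vec[of x] adj v_def)
    moreover have "cdot v v = of_real n"
      by (simp add: cdot_self n_def)
    ultimately have "Re (cdot z (A *v z)) = t\<^sup>2 * c - 2 * t * n"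
      using form by (simp add: z_def c_def v_def[symmetric] power2_eq_square ring_distribs)
    then show ?thesis using psd[of z] by simp
  qed
  \<comment> \<open>The choice \<open>t = n / (c + 1)\<close> makes \<open>t * c \<le> n\<close>,
    and \<open>c + 1\<close> keeps the denominator positive even when \<open>c = 0\<close>.\<close>
  from this[of "n / (c + 1)"] have "2 * n\<^sup>2 / (c + 1) \<le> n\<^sup>2 / (c + 1) * (c / (c + 1))"
    by (simp add: power2_eq_square)
  also have "\<dots> \<le> n\<^sup>2 / (c + 1) * 1"
    using c by (intro mult_left_mono) auto
  finally have "2 * n\<^sup>2 / (c + 1) \<le> n\<^sup>2 / (c + 1)" by simp
  moreover have "n\<^sup>2 / (c + 1) > 0" using n c by simp
  ultimately show False by simp
qed

text \<open>Testing against \<open>x\<close> itself gives a witness independent of \<open>z1\<close>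
  and \<open>z2\<close>, which serves both stability and hyperstability.\<close>

lemma form_nonzero:
  assumes R0: "hermitian_psd R0" and R1: "hermitian_psd R1" and R2: "hermitian_psd R2"
    and J: "skew_hermitian J"
    and z: "Re z1 > 0" "Re z2 > 0"
    and x: "R0 *v x \<noteq> 0 \<or> R1 *v x \<noteq> 0 \<or> R2 *v x \<noteq> 0"
  shows "cdot x (meval2 [:[:R0:], [:J + R1, R2:]:] z1 z2 *v x) \<noteq> 0"
proof
  define a where "a = (\<lambda>A. Re (cdot x (A *v x)))"
  have psd: "cdot x (A *v x) = of_real (a A)" "a A \<ge> 0" "a A = 0 \<Longrightarrow> A *v x = 0"
    if "hermitian_psd A" for A
    using that hermitian_form_real[of A x] psd_form_zero_imp_kernel[of A x]
    by (auto simp: a_def hermitian_psd_def complex_eq_iff)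
  have "cdot x (meval2 [:[:R0:], [:J + R1, R2:]:] z1 z2 *v x) =
      z1 * z2 * a R2 + z2 * (cdot x (J *v x) + a R1) + a R0"
    by (simp only: meval2_quadratic matrix_vector_mult_add_rdistrib mscale_mult_vec
        cdot_simps psd(1) R0 R1 R2)
  moreover have z2: "z2 \<noteq> 0" using z by auto
  then have "z2 * (a R0 / z2) = a R0" by simp
  ultimately have split: "cdot x (meval2 [:[:R0:], [:J + R1, R2:]:] z1 z2 *v x) =
      z2 * (z1 * a R2 + cdot x (J *v x) + a R1 + a R0 / z2)"
    by (simp only: ring_distribs mult_ac add.assoc)
  assume "cdot x (meval2 [:[:R0:], [:J + R1, R2:]:] z1 z2 *v x) = 0"
  with split z2 have "Re (z1 * a R2 + cdot x (J *v x) + a R1 + a R0 / z2) = 0" by simp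
  \<comment> \<open>The factor of \<open>a R0\<close> is the real part of \<open>1 / z2\<close>:
    inversion preserves the right half-plane. The form of \<open>J\<close> now stands without the
    factor \<open>z2\<close>, so it drops out of the real part.\<close>
  moreover have "Re (a R0 / z2) = a R0 * (Re z2 / (norm z2)\<^sup>2)"
    by (simp add: Re_divide cmod_power2)
  ultimately have sum0: "Re z1 * a R2 + a R1 + a R0 * (Re z2 / (norm z2)\<^sup>2) = 0"
    by (simp add: skew_hermitian_form_imaginary[OF J])
  have r: "Re z2 / (norm z2)\<^sup>2 > 0" using z z2 by simp
  have "Re z1 * a R2 \<ge> 0" "a R1 \<ge> 0" "a R0 * (Re z2 / (norm z2)\<^sup>2) \<ge> 0"
    using z r psd(2) R0 R1 R2 by (simp_all del: times_divide_eq_right)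
  with sum0 have "Re z1 * a R2 = 0" "a R1 = 0" "a R0 * (Re z2 / (norm z2)\<^sup>2) = 0"
    by linarith+
  then have "a R2 = 0" "a R1 = 0" "a R0 = 0"
    using z r by auto
  with x psd(3) R0 R1 R2 show False by blast
qed

text \<open>The direction of the image is the same at all points, which makes \<open>J *v x\<close>
  a uniform witness.\<close>

lemma meval2_common_kernel:
  assumes "R0 *v x = 0" "R1 *v x = 0" "R2 *v x = 0"
  shows "meval2 [:[:R0:], [:J + R1, R2:]:] z1 z2 *v x = z2 *s (J *v x)"
  using assms by (simp add: meval2_quadratic matrix_vector_mult_add_rdistrib mscale_mult_vec
      del: meval2_pCons)

theorem theorem7p3:
  fixes R0 R1 R2 J :: "complex^'n^'n"
  assumes "hermitian_psd R0" and "hermitian_psd R1" and "hermitian_psd R2"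
    and "skew_hermitian J"
    and "mker R0 \<inter> mker R1 \<inter> mker R2 \<inter> mker J = {0}"
  shows "stable2 right_half_plane [:[:R0:], [:J + R1, R2:]:]
       \<and> regular [:R0, J + R1, R2:]
       \<and> hyperstable right_half_plane [:R0, J + R1, R2:]"
proof (intro conjI)
  let ?R = "[:[:R0:], [:J + R1, R2:]:]" and ?P = "[:R0, J + R1, R2:]"
  note form = form_nonzero[OF assms(1-4)]
  \<comment> \<open>The quadratic is the restriction of the two-variable polynomial to the diagonal,
    so both one-variable claims reduce to facts about \<open>?R\<close>.\<close>
  have diag: "meval ?P z = meval2 ?R z z" for z
    by (simp only: meval_quadratic meval2_quadratic power2_eq_square)
  have J: "J *v x \<noteq> 0" if "x \<noteq> 0" "R0 *v x = 0" "R1 *v x = 0" "R2 *v x = 0" for x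
    using assms(5) that by (auto simp: mker_def)
  show stable: "stable2 right_half_plane ?R"
    unfolding stable2_def right_half_plane_def
  proof (intro ballI allI impI)
    fix z1 z2 and x :: "complex^'n"
    assume z: "z1 \<in> {z. Re z > 0}" "z2 \<in> {z. Re z > 0}" and x: "x \<noteq> 0"
    show "meval2 ?R z1 z2 *v x \<noteq> 0"
    proof (cases "R0 *v x = 0 \<and> R1 *v x = 0 \<and> R2 *v x = 0")
      case True
      then have "meval2 ?R z1 z2 *v x = z2 *s (J *v x)"
        using meval2_common_kernel by blast
      moreover have "z2 \<noteq> 0" "J *v x \<noteq> 0" using z J[OF x] True by auto
      ultimately show ?thesis by simp
    next
      case False
      then have "cdot x (meval2 ?R z1 z2 *v x) \<noteq> 0" using form z by blast
      then show ?thesis by (metis cdot_simps(6))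
    qed
  qed
  \<comment> \<open>The point 1 is just a convenient element of the half-plane; a nonzero
    determinant at one point already gives regularity.\<close>
  have "meval ?P 1 *v x \<noteq> 0" if "x \<noteq> 0" for x
    using stable that unfolding diag stable2_def right_half_plane_def by fastforce
  then have "det (meval ?P 1) \<noteq> 0"
    by (metis invertible_det_nz invertible_left_inverse matrix_left_invertible_ker)
  then show "regular ?P"
    unfolding regular_def by (metis poly_0 poly_det_entries)
  show "hyperstable right_half_plane ?P"
    unfolding hyperstable_def right_half_plane_def diag
  proof (intro allI impI)
    fix x :: "complex^'n"
    assume x: "x \<noteq> 0"
    show "\<exists>y. y \<noteq> 0 \<and> (\<forall>z\<in>{z. Re z > 0}. cdot y (meval2 ?R z z *v x) \<noteq> 0)"
    proof (cases "R0 *v x = 0 \<and> R1 *v x = 0 \<and> R2 *v x = 0")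
      case True
      then have "J *v x \<noteq> 0" using J[OF x] by blast
      moreover have "meval2 ?R z z *v x = z *s (J *v x)" for z
        using True meval2_common_kernel by blast
      moreover have "z \<noteq> 0" if "Re z > 0" for z :: complex using that by auto
      ultimately show ?thesis
        \<comment> \<open>The tested value is \<open>z\<close> times the squared norm of
          \<open>J *v x\<close>.\<close>
        by (intro exI[of _ "J *v x"]) (simp add: cdot_self del: meval2_pCons)
    next
      case False
      then show ?thesis using form x by blast
    qed
  qed
qed

end
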